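(* Let $n\ge1$, $r>0$, $a_i,b_i\in C(\mathbb{R},\mathbb{R})$ for $i=1,\dots,n$, $\mathbf{A}(t)=\mathrm{diag}[a_1(t),\dots,a_n(t)]$, $\mathbf{B}(t)=\mathrm{diag}[b_1(t),\dots,b_n(t)]$, and let $\mathbf{F}:\mathscr{C}\to\mathbb{R}^n$ be continuous with $\mathbf{F}(\hat 0)=0$. Assume: (i) $\int_0^t a_i(s)\,ds\to+\infty$ as $t\to+\infty$, for each $i=1,\dots,n$; (ii) $L>0$ and $K_L>0$ are constants such that $|\mathbf{F}(\varphi)-\mathbf{F}(\psi)|\le K_L\|\varphi-\psi\|$ for all $\varphi,\psi\in\mathscr{C}_L:=\{\mathbf{x}\in\mathscr{C}:\|\mathbf{x}\|\le L\}$; (iii) there exists $\alpha\in(0,1)$ such that $$K_L\int_0^t\exp\Big\{-\int_s^t a_i(u)\,du\Big\}|b_i(s)|\,ds\le\alpha\qquad\text{for all } t\ge0,\ i=1,\dots,n.$$ Then the zero solution of $$\mathbf{x}'(t)=-\mathbf{A}(t)\mathbf{x}(t)+\mathbf{B}(t)\mathbf{F}(\mathbf{x}_t)$$ is asymptotically stable.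
   Context: $\mathbb{R}^n$ carries the max norm $|\cdot|$. $\mathscr{C}=C([-r,0],\mathbb{R}^n)$ is the Banach space of continuous functions with norm $\|\phi\|=\sup_{-r\le\theta\le0}|\phi(\theta)|$, and $\hat0$ is its zero element. For a function $\mathbf{x}$ continuous on $[t_0-r,\infty)$ and $t\ge t_0$, $\mathbf{x}_t\in\mathscr{C}$ is $\mathbf{x}_t(\theta)=\mathbf{x}(t+\theta)$, $\theta\in[-r,0]$. For $t_0\ge0$ and $\phi\in\mathscr{C}$, $\mathbf{x}(t,t_0,\phi)$ denotes the solution for $t\ge t_0$ with $\mathbf{x}_{t_0}=\phi$. Asymptotic stability of the zero solution is meant in the usual (not necessarily uniform) sense: (stability) for every $t_0\ge0$ and $\varepsilon>0$ there is $\delta=\delta(t_0,\varepsilon)>0$ such that $\|\phi\|\le\delta$ implies that $\mathbf{x}(t,t_0,\phi)$ exists for all $t\ge t_0$ and $|\mathbf{x}(t,t_0,\phi)|<\varepsilon$ for all $t\ge t_0$; and (attractivity) for every $t_0\ge0$ there is $\delta=\delta(t_0)>0$ such that $\|\phi\|\le\delta$ implies $\lim_{t\to+\infty}\mathbf{x}(t,t_0,\phi)=0$. *)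

theory Defs
  imports "HOL-Analysis.Analysis"
begin

text \<open>
  \<open>\<real>\<^sup>n\<close> is \<^typ>\<open>real ^ 'n\<close>. Its \<^const>\<open>norm\<close> is Euclidean, so the max norm is
  \<^const>\<open>infnorm\<close> throughout.

  The domain \<open>[-r, 0]\<close> depends on a term, so \<open>C([-r,0], \<real>\<^sup>n)\<close> is a set of functions. They are
  required to be extensional (\<^const>\<open>undefined\<close> off \<open>[-r, 0]\<close>), so that equality in this set is
  equality on \<open>[-r, 0]\<close> and a functional on it cannot see anything outside that interval.
\<close>

definition hist_space :: "real \<Rightarrow> (real \<Rightarrow> real ^ 'n) set" where
  "hist_space r = {\<phi> \<in> extensional {-r..0}. continuous_on {-r..0} \<phi>}"

definition hist_norm :: "real \<Rightarrow> (real \<Rightarrow> real ^ 'n) \<Rightarrow> real" where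
  "hist_norm r \<phi> = (SUP \<theta>\<in>{-r..0}. infnorm (\<phi> \<theta>))"

definition hist_dist :: "real \<Rightarrow> (real \<Rightarrow> real ^ 'n) \<Rightarrow> (real \<Rightarrow> real ^ 'n) \<Rightarrow> real" where
  "hist_dist r \<phi> \<psi> = hist_norm r (\<lambda>\<theta>. \<phi> \<theta> - \<psi> \<theta>)"

definition hist_zero :: "real \<Rightarrow> real \<Rightarrow> real ^ 'n" where
  "hist_zero r = restrict (\<lambda>\<theta>. 0) {-r..0}"

definition hist_continuous :: "real \<Rightarrow> ((real \<Rightarrow> real ^ 'n) \<Rightarrow> real ^ 'n) \<Rightarrow> bool" where
  "hist_continuous r F \<longleftrightarrow>
     (\<forall>\<phi>\<in>hist_space r. \<forall>\<epsilon>>0. \<exists>\<delta>>0. \<forall>\<psi>\<in>hist_space r.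
        hist_dist r \<psi> \<phi> < \<delta> \<longrightarrow> infnorm (F \<psi> - F \<phi>) < \<epsilon>)"

text \<open>The segment \<open>x\<^sub>t\<close>.\<close>

definition segment :: "real \<Rightarrow> (real \<Rightarrow> real ^ 'n) \<Rightarrow> real \<Rightarrow> real \<Rightarrow> real ^ 'n" where
  "segment r x t = restrict (\<lambda>\<theta>. x (t + \<theta>)) {-r..0}"

definition diag :: "('n \<Rightarrow> real) \<Rightarrow> real ^ 'n ^ 'n" where
  "diag d = (\<chi> i j. if i = j then d i else 0)"

text \<open>
  Solutions of \<open>x'(t) = f(t, x\<^sub>t)\<close> with \<open>x\<^sub>t\<^sub>0 = \<phi>\<close>. Here \<open>J\<close> is an interval with left endpoint
  \<open>t0\<close> (either \<open>[t0, \<infinity>)\<close> or \<open>[t0, T]\<close>); derivatives at its endpoints are one-sided.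
\<close>

definition dde_solution_on ::
  "real \<Rightarrow> (real \<Rightarrow> (real \<Rightarrow> real ^ 'n) \<Rightarrow> real ^ 'n) \<Rightarrow> real \<Rightarrow> (real \<Rightarrow> real ^ 'n)
     \<Rightarrow> real set \<Rightarrow> (real \<Rightarrow> real ^ 'n) \<Rightarrow> bool" where
  "dde_solution_on r f t0 \<phi> J x \<longleftrightarrow>
     continuous_on ({t0 - r..t0} \<union> J) x \<and>
     segment r x t0 = \<phi> \<and>
     (\<forall>t\<in>J. (x has_vector_derivative f t (segment r x t)) (at t within J))"

text \<open>
  The solution \<open>x(\<cdot>, t0, \<phi>)\<close> exists on all of \<open>[t0, \<infinity>)\<close> and is \<open>x\<close>. Comparing with solutions on
  every \<open>[t0, T]\<close>, not only with global ones, also excludes a second solution that breaks down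
  in finite time.
\<close>

definition is_global_dde_solution ::
  "real \<Rightarrow> (real \<Rightarrow> (real \<Rightarrow> real ^ 'n) \<Rightarrow> real ^ 'n) \<Rightarrow> real \<Rightarrow> (real \<Rightarrow> real ^ 'n)
     \<Rightarrow> (real \<Rightarrow> real ^ 'n) \<Rightarrow> bool" where
  "is_global_dde_solution r f t0 \<phi> x \<longleftrightarrow>
     dde_solution_on r f t0 \<phi> {t0..} x \<and>
     (\<forall>T>t0. \<forall>y. dde_solution_on r f t0 \<phi> {t0..T} y \<longrightarrow> (\<forall>t\<in>{t0..T}. y t = x t))"

definition zero_stable ::
  "real \<Rightarrow> (real \<Rightarrow> (real \<Rightarrow> real ^ 'n) \<Rightarrow> real ^ 'n) \<Rightarrow> bool" where
  "zero_stable r f \<longleftrightarrow>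
     (\<forall>t0\<ge>0. \<forall>\<epsilon>>0. \<exists>\<delta>>0. \<forall>\<phi>\<in>hist_space r. hist_norm r \<phi> \<le> \<delta> \<longrightarrow>
        (\<exists>x. is_global_dde_solution r f t0 \<phi> x \<and> (\<forall>t\<ge>t0. infnorm (x t) < \<epsilon>)))"

definition zero_attractive ::
  "real \<Rightarrow> (real \<Rightarrow> (real \<Rightarrow> real ^ 'n) \<Rightarrow> real ^ 'n) \<Rightarrow> bool" where
  "zero_attractive r f \<longleftrightarrow>
     (\<forall>t0\<ge>0. \<exists>\<delta>>0. \<forall>\<phi>\<in>hist_space r. hist_norm r \<phi> \<le> \<delta> \<longrightarrow>
        (\<exists>x. is_global_dde_solution r f t0 \<phi> x \<and> (x \<longlongrightarrow> 0) at_top))"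

definition zero_asymptotically_stable ::
  "real \<Rightarrow> (real \<Rightarrow> (real \<Rightarrow> real ^ 'n) \<Rightarrow> real ^ 'n) \<Rightarrow> bool" where
  "zero_asymptotically_stable r f \<longleftrightarrow> zero_stable r f \<and> zero_attractive r f"

text \<open>
  Right-hand side of \<open>x'(t) = - A(t) x(t) + B(t) F(x\<^sub>t)\<close> as a function of \<open>t\<close> and \<open>\<psi> = x\<^sub>t\<close>;
  \<open>x(t)\<close> is \<open>\<psi> 0\<close>.
\<close>

definition delay_rhs ::
  "('n \<Rightarrow> real \<Rightarrow> real) \<Rightarrow> ('n \<Rightarrow> real \<Rightarrow> real) \<Rightarrow> ((real \<Rightarrow> real ^ 'n) \<Rightarrow> real ^ 'n)
     \<Rightarrow> real \<Rightarrow> (real \<Rightarrow> real ^ 'n) \<Rightarrow> real ^ 'n" where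
  "delay_rhs a b F t \<psi> = - (diag (\<lambda>i. a i t) *v \<psi> 0) + diag (\<lambda>i. b i t) *v F \<psi>"

end

theory Submission
  imports Defs
begin

text \<open>
  Write \<open>A\<^sub>i(t)\<close> for the integral of \<open>a\<^sub>i\<close> over \<open>[0, t]\<close>. With the integrating factor \<open>exp A\<^sub>i\<close> the
  equation becomes the fixed-point problem \<open>x = duhamel t0 x\<close>, where the \<open>i\<close>-th component of
  \<open>duhamel s x t\<close> is
  \<open>exp (A\<^sub>i(s) - A\<^sub>i(t)) x\<^sub>i(s) + \<integral>\<^sub>s\<^sup>t exp (A\<^sub>i(u) - A\<^sub>i(t)) b\<^sub>i(u) F\<^sub>i(x\<^sub>u) du\<close>.
  On functions bounded by \<open>L\<close> the functional is \<open>K\<close>-Lipschitz, so by the integral bound on the kernel the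
  memory integral is \<open>\<alpha>\<close>-Lipschitz in the supremum of the maximum norm. This estimate, lemma
  \<open>duhamel_diff_le\<close>, gives every part of the theorem.

  Existence and stability: the factor \<open>exp (A\<^sub>i(t0) - A\<^sub>i(t))\<close> is bounded by some \<open>M\<close>, since
  \<open>A\<^sub>i\<close> tends to infinity. For a history of size at most \<open>\<delta>\<close> with \<open>M \<delta> + \<alpha> c \<le> c\<close>, the operator
  maps the functions with that history and bound \<open>c\<close> into themselves, and Banach's theorem
  provides a solution bounded by \<open>c\<close> (\<open>duhamel_fixed_point_exists\<close>).

  Uniqueness: two solutions in the ball of radius \<open>L\<close> agree by contraction, and when \<open>c < L\<close> a
  second solution has no first time at which to leave that ball (\<open>solution_unique\<close>).

  Attractivity: if \<open>c \<le> L\<close> eventually bounds the solution, restarting the formula late turns the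
  bound into \<open>\<alpha> c\<close> plus a term that tends to \<open>0\<close>, hence eventually into \<open>(1 + \<alpha>) / 2 * c\<close>.
  Iterating gives the limit \<open>0\<close> (\<open>bounded_solution_tendsto_0\<close>). Decay thus follows
  for every solution bounded by \<open>L\<close>, so the fixed-point argument runs in a space of merely
  bounded functions.
\<close>

section \<open>The maximum norm\<close>

lemma infnorm_leI_cart:
  fixes x :: "real ^ 'n"
  assumes "\<And>i. \<bar>x $ i\<bar> \<le> d"
  shows "infnorm x \<le> d"
  unfolding infnorm_cart by (rule cSup_least) (use assms in auto)

lemma norm_le_sqrt_card_infnorm:
  fixes x :: "real ^ 'n"
  shows "norm x \<le> sqrt (real CARD('n)) * infnorm x"
  using norm_le_infnorm[of x] by simp

section \<open>Calculus on half-lines and fixed points\<close>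

lemma continuous_on_atLeastI:
  fixes f :: "real \<Rightarrow> 'a::topological_space"
  assumes "\<And>T. continuous_on {a..T} f"
  shows "continuous_on {a..} f"
  unfolding continuous_on_def
proof
  fix t assume "t \<in> {a..}"
  then have "(f \<longlongrightarrow> f t) (at t within {a..t+1})"
    using assms[of "t+1"] by (simp add: continuous_on_def)
  moreover have "at t within {a..t+1} = at t within {a..}"
    by (rule at_within_nhd[where S = "{..<t+1}"]) auto
  ultimately show "(f \<longlongrightarrow> f t) (at t within {a..})" by simp
qed

lemma integral_has_real_derivative_atLeast:
  fixes g :: "real \<Rightarrow> real"
  assumes g: "continuous_on {a..} g" and t: "a \<le> t"
  shows "((\<lambda>u. integral {a..u} g) has_real_derivative g t) (at t within {a..})"
proof -
  have "((\<lambda>u. integral {a..u} g) has_real_derivative g t) (at t within {a..t+1})"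
    by (rule integral_has_real_derivative) (use t continuous_on_subset[OF g] in auto)
  moreover have "at t within {a..t+1} = at t within {a..}"
    by (rule at_within_nhd[where S = "{..<t+1}"]) auto
  ultimately show ?thesis by simp
qed

lemma has_vector_derivative_componentwise_cart:
  fixes x :: "real \<Rightarrow> real ^ 'n"
  assumes "\<And>i. ((\<lambda>t. x t $ i) has_real_derivative v $ i) (at t within S)"
  shows "(x has_vector_derivative v) (at t within S)"
  unfolding has_vector_derivative_def
proof (subst has_derivative_componentwise_within, intro ballI)
  fix b :: "real ^ 'n" assume "b \<in> Basis"
  then obtain i where b: "b = axis i 1" by (auto simp: Basis_vec_def)
  show "((\<lambda>t. x t \<bullet> b) has_derivative (\<lambda>h. h *\<^sub>R v \<bullet> b)) (at t within S)"
    using assms[of i, unfolded has_real_derivative_iff_has_vector_derivative has_vector_derivative_def]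
    by (simp add: b inner_axis)
qed

text \<open>If some iterate of \<open>f\<close> contracts, its unique fixed point \<open>x\<close> is one of \<open>f\<close>:
  the iterate also fixes \<open>f x\<close>.\<close>

lemma Banach_fix_iterate:
  fixes f :: "'a::metric_space \<Rightarrow> 'a"
  assumes S: "complete S" "S \<noteq> {}" and c: "0 \<le> c" "c < 1" and f: "f ` S \<subseteq> S"
    and lip: "\<And>x y. x \<in> S \<Longrightarrow> y \<in> S \<Longrightarrow> dist ((f ^^ k) x) ((f ^^ k) y) \<le> c * dist x y"
  shows "\<exists>x\<in>S. f x = x"
proof -
  have "(f ^^ m) x \<in> S" if "x \<in> S" for m x
    using that f by (induction m) auto
  then have "\<exists>!x\<in>S. (f ^^ k) x = x"
    by (intro Banach_fix[OF S c] lip) auto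
  then obtain x where x: "x \<in> S" "(f ^^ k) x = x"
    and uniq: "\<And>y. y \<in> S \<Longrightarrow> (f ^^ k) y = y \<Longrightarrow> y = x" by blast
  have "(f ^^ k) (f x) = f x"
    using x(2) by (metis funpow_swap1)
  then show ?thesis
    using uniq[of "f x"] f x(1) by auto
qed

section \<open>Histories\<close>

lemma hist_norm_ge:
  assumes "\<phi> \<in> hist_space r" "\<theta> \<in> {-r..0}"
  shows "infnorm (\<phi> \<theta>) \<le> hist_norm r \<phi>"
  unfolding hist_norm_def
proof (rule cSUP_upper[OF assms(2)])
  have "compact ((\<lambda>\<theta>. infnorm (\<phi> \<theta>)) ` {-r..0})"
    using assms(1) by (intro compact_continuous_image continuous_intros) (auto simp: hist_space_def)
  then show "bdd_above ((\<lambda>\<theta>. infnorm (\<phi> \<theta>)) ` {-r..0})"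
    by (simp add: bounded_imp_bdd_above compact_imp_bounded)
qed

lemma segment_in_hist_space:
  assumes "continuous_on {t - r..t} x"
  shows "segment r x t \<in> hist_space r"
proof -
  have "continuous_on {-r..0} (\<lambda>\<theta>. x (t + \<theta>))"
    by (rule continuous_on_compose2[OF assms]) (auto intro!: continuous_intros)
  then have "continuous_on {-r..0} (segment r x t)"
    by (rule continuous_on_eq) (simp add: segment_def)
  then show ?thesis by (simp add: hist_space_def segment_def)
qed

lemma hist_norm_segment_le:
  assumes "r > 0" "\<And>u. u \<in> {t - r..t} \<Longrightarrow> infnorm (x u) \<le> c"
  shows "hist_norm r (segment r x t) \<le> c"
  unfolding hist_norm_def by (rule cSUP_least) (use assms in \<open>auto simp: segment_def\<close>)

lemma hist_dist_segment_le:
  assumes "r > 0" "\<And>\<theta>. \<theta> \<in> {-r..0} \<Longrightarrow> infnorm (x (t + \<theta>) - y (s + \<theta>)) \<le> c"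
  shows "hist_dist r (segment r x t) (segment r y s) \<le> c"
  unfolding hist_dist_def hist_norm_def
  by (rule cSUP_least) (use assms in \<open>auto simp: segment_def\<close>)

lemma segment_zero: "segment r (\<lambda>_. 0) t = hist_zero r"
  by (simp add: segment_def hist_zero_def)

lemma diag_mult_nth: "(diag d *v v) $ i = d i * v $ i"
  by (simp add: diag_def matrix_vector_mult_def if_distrib[of "\<lambda>z. z * _"] sum.delta cong: if_cong)

lemma delay_rhs_nth:
  assumes "r > 0"
  shows "delay_rhs a b F t (segment r x t) $ i =
    - (a i t * x t $ i) + b i t * F (segment r x t) $ i"
  using assms by (simp add: delay_rhs_def diag_mult_nth segment_def)

text \<open>The segment \<open>x\<^sub>t\<close> moves continuously with \<open>t\<close> because \<open>x\<close> is uniformly continuous on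
  compact intervals.\<close>

lemma continuous_on_functional_segment:
  assumes r: "r > 0" and F: "hist_continuous r F" and x: "continuous_on {s - r..T} x"
  shows "continuous_on {s..T} (\<lambda>t. F (segment r x t))"
  unfolding continuous_on_iff
proof (intro ballI allI impI)
  fix t and \<epsilon> :: real assume t: "t \<in> {s..T}" and \<epsilon>: "\<epsilon> > 0"
  have seg: "segment r x u \<in> hist_space r" if "u \<in> {s..T}" for u
    using that by (intro segment_in_hist_space continuous_on_subset[OF x]) auto
  let ?q = "sqrt (real CARD('a))"
  have q: "?q > 0" by simp
  obtain \<delta> where \<delta>: "\<delta> > 0" and Fd: "\<And>\<psi>. \<psi> \<in> hist_space r \<Longrightarrow>
      hist_dist r \<psi> (segment r x t) < \<delta> \<Longrightarrow> infnorm (F \<psi> - F (segment r x t)) < \<epsilon> / ?q"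
    using F[unfolded hist_continuous_def, rule_format, OF seg[OF t] divide_pos_pos[OF \<epsilon> q]]
    by blast
  have "uniformly_continuous_on {s - r..T} x"
    by (rule compact_uniformly_continuous[OF x]) simp
  then obtain d where d: "d > 0" and xd: "\<And>u v. u \<in> {s-r..T} \<Longrightarrow> v \<in> {s-r..T} \<Longrightarrow>
      dist v u < d \<Longrightarrow> dist (x v) (x u) < \<delta> / 2"
    using half_gt_zero[OF \<delta>] unfolding uniformly_continuous_on_def by blast
  show "\<exists>d>0. \<forall>u\<in>{s..T}. dist u t < d \<longrightarrow> dist (F (segment r x u)) (F (segment r x t)) < \<epsilon>"
  proof (intro exI[of _ d] conjI ballI impI d)
    fix u assume u: "u \<in> {s..T}" and ut: "dist u t < d"
    have "hist_dist r (segment r x u) (segment r x t) \<le> \<delta> / 2"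
    proof (rule hist_dist_segment_le[OF r])
      fix \<theta> assume "\<theta> \<in> {-r..0}"
      then have "dist (x (u + \<theta>)) (x (t + \<theta>)) < \<delta> / 2"
        using t u ut by (intro xd) (auto simp: dist_real_def)
      then show "infnorm (x (u + \<theta>) - x (t + \<theta>)) \<le> \<delta> / 2"
        using infnorm_le_norm[of "x (u + \<theta>) - x (t + \<theta>)"] by (simp add: dist_norm)
    qed
    then have "infnorm (F (segment r x u) - F (segment r x t)) < \<epsilon> / ?q"
      using \<delta> by (intro Fd seg u) simp
    then have "?q * infnorm (F (segment r x u) - F (segment r x t)) < \<epsilon>"
      using q by (simp add: field_simps)
    then show "dist (F (segment r x u)) (F (segment r x t)) < \<epsilon>"
      using norm_le_sqrt_card_infnorm[of "F (segment r x u) - F (segment r x t)"]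
      by (simp add: dist_norm)
  qed
qed

section \<open>Variation of constants\<close>

locale diagonal_delay_equation =
  fixes r L K \<alpha> :: real
    and a b :: "'n::finite \<Rightarrow> real \<Rightarrow> real"
    and F :: "(real \<Rightarrow> real ^ 'n) \<Rightarrow> real ^ 'n"
  assumes r: "r > 0"
    and a: "\<And>i. continuous_on UNIV (a i)"
    and b: "\<And>i. continuous_on UNIV (b i)"
    and F: "hist_continuous r F"
    and F_zero: "F (hist_zero r) = 0"
    and a_diverges: "\<And>i. filterlim (\<lambda>t. integral {0..t} (a i)) at_top at_top"
    and L: "L > 0" and K: "K > 0"
    and F_lipschitz: "\<And>\<phi> \<psi>. \<phi> \<in> hist_space r \<Longrightarrow> \<psi> \<in> hist_space r \<Longrightarrow>
           hist_norm r \<phi> \<le> L \<Longrightarrow> hist_norm r \<psi> \<le> L \<Longrightarrow>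
           infnorm (F \<phi> - F \<psi>) \<le> K * hist_dist r \<phi> \<psi>"
    and \<alpha>: "0 < \<alpha>" "\<alpha> < 1"
    and contraction: "\<And>t i. t \<ge> 0 \<Longrightarrow>
           K * integral {0..t} (\<lambda>s. exp (- integral {s..t} (a i)) * \<bar>b i s\<bar>) \<le> \<alpha>"
begin

definition A :: "'n \<Rightarrow> real \<Rightarrow> real" where
  "A i t = integral {0..t} (a i)"

text \<open>The right-hand side of the variation-of-constants formula restarted at time \<open>s\<close>, with
  the kernel \<open>exp (- (A i t - A i u))\<close> split into factors so that \<open>t\<close> leaves the integral.\<close>

definition duhamel :: "real \<Rightarrow> (real \<Rightarrow> real ^ 'n) \<Rightarrow> real \<Rightarrow> real ^ 'n" where
  "duhamel s x t = (\<chi> i. exp (- A i t) *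
     (exp (A i s) * x s $ i + integral {s..t} (\<lambda>u. exp (A i u) * (b i u * F (segment r x u) $ i))))"

lemma A_has_derivative:
  assumes "0 \<le> t"
  shows "(A i has_real_derivative a i t) (at t within {0..})"
  unfolding A_def[abs_def]
  by (rule integral_has_real_derivative_atLeast) (use assms continuous_on_subset[OF a] in auto)

lemma continuous_on_A: "continuous_on {0..} (A i)"
  by (rule DERIV_continuous_on[OF A_has_derivative]) simp

lemma integral_a:
  assumes "0 \<le> s" "s \<le> t"
  shows "integral {s..t} (a i) = A i t - A i s"
proof -
  have "a i integrable_on {0..t}"
    by (rule integrable_continuous_real[OF continuous_on_subset[OF a]]) simp
  from Henstock_Kurzweil_Integration.integral_combine[OF assms this] show ?thesis
    by (simp add: A_def)
qed

lemma A_at_top: "filterlim (A i) at_top at_top"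
  unfolding A_def[abs_def] by (rule a_diverges)

text \<open>Starting the integral at \<open>s\<close> instead of \<open>0\<close> only drops a nonnegative part of the integrand.\<close>

lemma kernel_integral_le:
  assumes "0 \<le> s" "s \<le> t"
  shows "K * (exp (- A i t) * integral {s..t} (\<lambda>u. exp (A i u) * \<bar>b i u\<bar>)) \<le> \<alpha>"
proof -
  let ?g = "\<lambda>u. exp (A i u) * \<bar>b i u\<bar>"
  have int: "?g integrable_on {p..q}" if "0 \<le> p" for p q
    using that by (intro integrable_continuous_real continuous_intros
        continuous_on_subset[OF continuous_on_A] continuous_on_subset[OF b]) auto
  have "integral {s..t} ?g \<le> integral {0..t} ?g"
    by (rule integral_subset_le) (use assms int in auto)
  then have "K * (exp (- A i t) * integral {s..t} ?g) \<le> K * (exp (- A i t) * integral {0..t} ?g)"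
    using K by simp
  also have "exp (- A i t) * integral {0..t} ?g = integral {0..t} (\<lambda>u. exp (- A i t) * ?g u)"
    by simp
  also have "\<dots> = integral {0..t} (\<lambda>u. exp (- integral {u..t} (a i)) * \<bar>b i u\<bar>)"
    by (rule integral_cong) (auto simp: integral_a exp_add[symmetric] mult.assoc[symmetric])
  also have "K * \<dots> \<le> \<alpha>"
    using assms by (intro contraction) simp
  finally show ?thesis .
qed

lemma F_segment_lipschitz:
  assumes "continuous_on {t - r..t} x" "continuous_on {t - r..t} y"
    and "\<And>u. u \<in> {t - r..t} \<Longrightarrow> infnorm (x u) \<le> L"
    and "\<And>u. u \<in> {t - r..t} \<Longrightarrow> infnorm (y u) \<le> L"
    and "\<And>u. u \<in> {t - r..t} \<Longrightarrow> infnorm (x u - y u) \<le> d"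
  shows "infnorm (F (segment r x t) - F (segment r y t)) \<le> K * d"
proof -
  have "hist_dist r (segment r x t) (segment r y t) \<le> d"
    using assms(5) by (intro hist_dist_segment_le r) auto
  then have "K * hist_dist r (segment r x t) (segment r y t) \<le> K * d"
    using K by simp
  moreover have "infnorm (F (segment r x t) - F (segment r y t))
      \<le> K * hist_dist r (segment r x t) (segment r y t)"
    by (intro F_lipschitz segment_in_hist_space hist_norm_segment_le r assms)
  ultimately show ?thesis by linarith
qed

lemma continuous_on_duhamel_integrand:
  assumes "0 \<le> s" "continuous_on {s - r..T} x"
  shows "continuous_on {s..T} (\<lambda>u. exp (A i u) * (b i u * F (segment r x u) $ i))"
proof -
  have "continuous_on {s..T} (A i)"
    by (rule continuous_on_subset[OF continuous_on_A]) (use assms in auto)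
  moreover have "continuous_on {s..T} (b i)"
    by (rule continuous_on_subset[OF b]) simp
  moreover have "continuous_on {s..T} (\<lambda>u. F (segment r x u))"
    by (rule continuous_on_functional_segment[OF r F assms(2)])
  ultimately show ?thesis
    by (intro continuous_on_mult continuous_on_exp continuous_on_component)
qed

text \<open>Everything rests on this estimate: the memory part of the formula contracts by \<open>\<alpha>\<close> in
  the maximum norm, and the initial part is damped by \<open>exp (- (A i t - A i s))\<close>.\<close>

lemma duhamel_diff_le:
  assumes s: "0 \<le> s" "s \<le> t"
    and cont: "continuous_on {s - r..t} x" "continuous_on {s - r..t} y"
    and xL: "\<And>u. u \<in> {s - r..t} \<Longrightarrow> infnorm (x u) \<le> L"
    and yL: "\<And>u. u \<in> {s - r..t} \<Longrightarrow> infnorm (y u) \<le> L"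
    and d: "\<And>u. u \<in> {s - r..t} \<Longrightarrow> infnorm (x u - y u) \<le> d"
  shows "\<bar>duhamel s x t $ i - duhamel s y t $ i\<bar>
    \<le> exp (A i s - A i t) * \<bar>x s $ i - y s $ i\<bar> + \<alpha> * d"
proof -
  let ?g = "\<lambda>z u. exp (A i u) * (b i u * F (segment r z u) $ i)"
  have int: "?g z integrable_on {s..t}" if "continuous_on {s - r..t} z" for z
    by (intro integrable_continuous_real continuous_on_duhamel_integrand s that)
  have d0: "0 \<le> d"
    using d[of s] s r infnorm_pos_le[of "x s - y s"] by auto
  have "\<bar>integral {s..t} (?g x) - integral {s..t} (?g y)\<bar>
      = \<bar>integral {s..t} (\<lambda>u. ?g x u - ?g y u)\<bar>"
    by (simp only: integral_diff[OF int[OF cont(1)] int[OF cont(2)]])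
  also have "\<dots> \<le> integral {s..t} (\<lambda>u. (exp (A i u) * \<bar>b i u\<bar>) * (K * d))"
  proof (rule integral_norm_bound_integral[where 'a = real, unfolded real_norm_def])
    show "(\<lambda>u. ?g x u - ?g y u) integrable_on {s..t}"
      by (intro integrable_diff int cont)
    show "(\<lambda>u. (exp (A i u) * \<bar>b i u\<bar>) * (K * d)) integrable_on {s..t}"
      using s by (intro integrable_continuous_real continuous_intros
        continuous_on_subset[OF continuous_on_A] continuous_on_subset[OF b]) auto
    fix u assume u: "u \<in> {s..t}"
    have "infnorm (F (segment r x u) - F (segment r y u)) \<le> K * d"
      using u r by (intro F_segment_lipschitz continuous_on_subset[OF cont(1)]
          continuous_on_subset[OF cont(2)] xL yL d) auto
    then have "\<bar>F (segment r x u) $ i - F (segment r y u) $ i\<bar> \<le> K * d"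
      using component_le_infnorm_cart[of "F (segment r x u) - F (segment r y u)" i] by simp
    then have "(exp (A i u) * \<bar>b i u\<bar>) * \<bar>F (segment r x u) $ i - F (segment r y u) $ i\<bar>
        \<le> (exp (A i u) * \<bar>b i u\<bar>) * (K * d)"
      by (intro mult_left_mono) auto
    moreover have "?g x u - ?g y u
        = exp (A i u) * b i u * (F (segment r x u) $ i - F (segment r y u) $ i)"
      by (simp add: algebra_simps)
    ultimately show "\<bar>?g x u - ?g y u\<bar> \<le> (exp (A i u) * \<bar>b i u\<bar>) * (K * d)"
      by (simp add: abs_mult)
  qed
  also have "\<dots> = integral {s..t} (\<lambda>u. exp (A i u) * \<bar>b i u\<bar>) * (K * d)"
    by (rule integral_mult_left)
  finally have "exp (- A i t) * \<bar>integral {s..t} (?g x) - integral {s..t} (?g y)\<bar>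
      \<le> exp (- A i t) * (integral {s..t} (\<lambda>u. exp (A i u) * \<bar>b i u\<bar>) * (K * d))"
    by simp
  also have "\<dots> = K * (exp (- A i t) * integral {s..t} (\<lambda>u. exp (A i u) * \<bar>b i u\<bar>)) * d"
    by simp
  also have "\<dots> \<le> \<alpha> * d"
    by (intro mult_right_mono kernel_integral_le s d0)
  finally have memory: "exp (- A i t) * \<bar>integral {s..t} (?g x) - integral {s..t} (?g y)\<bar> \<le> \<alpha> * d" .
  have factor: "exp (A i s - A i t) = exp (- A i t) * exp (A i s)"
    by (simp add: exp_add[symmetric])
  have "duhamel s x t $ i - duhamel s y t $ i = exp (A i s - A i t) * (x s $ i - y s $ i)
      + exp (- A i t) * (integral {s..t} (?g x) - integral {s..t} (?g y))"
    unfolding duhamel_def vec_lambda_beta factor by algebra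
  then have "\<bar>duhamel s x t $ i - duhamel s y t $ i\<bar> \<le> exp (A i s - A i t) * \<bar>x s $ i - y s $ i\<bar>
      + exp (- A i t) * \<bar>integral {s..t} (?g x) - integral {s..t} (?g y)\<bar>"
    by (auto simp: abs_mult intro: order_trans[OF abs_triangle_ineq])
  also note memory
  finally show ?thesis by simp
qed

lemma duhamel_zero: "duhamel s (\<lambda>_. 0) t = 0"
  by (simp add: duhamel_def segment_zero F_zero vec_eq_iff)

lemma duhamel_le:
  assumes "0 \<le> s" "s \<le> t" "continuous_on {s - r..t} x" "c \<le> L"
    and "\<And>u. u \<in> {s - r..t} \<Longrightarrow> infnorm (x u) \<le> c"
  shows "\<bar>duhamel s x t $ i\<bar> \<le> exp (A i s - A i t) * \<bar>x s $ i\<bar> + \<alpha> * c"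
  using duhamel_diff_le[of s t x "\<lambda>_. 0" c i] assms L
  by (auto simp: duhamel_zero infnorm_0 intro: order_trans)

lemma duhamel_has_derivative:
  assumes s: "0 \<le> s" "s \<le> t" and x: "continuous_on {s - r..} x"
  shows "((\<lambda>t. duhamel s x t $ i) has_real_derivative
    - (a i t * duhamel s x t $ i) + b i t * F (segment r x t) $ i) (at t within {s..})"
proof -
  let ?g = "\<lambda>u. exp (A i u) * (b i u * F (segment r x u) $ i)"
  have "continuous_on {s..} ?g"
    by (intro continuous_on_atLeastI continuous_on_duhamel_integrand s continuous_on_subset[OF x]) auto
  note I = integral_has_real_derivative_atLeast[OF this s(2)]
  have "(A i has_real_derivative a i t) (at t within {s..})"
    by (rule DERIV_subset[OF A_has_derivative]) (use s in auto)
  from this I show ?thesis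
    unfolding duhamel_def vec_lambda_beta
    by (auto intro!: derivative_eq_intros simp: exp_minus field_simps)
qed

text \<open>The integrating factor \<open>exp (A i t)\<close> turns the \<open>i\<close>-th equation into
  \<open>(exp (A i t) * x\<^sub>i)' = exp (A i t) * (b i t * F\<^sub>i)\<close>, which is integrated from \<open>s\<close> to \<open>t\<close>.\<close>

lemma solution_eq_duhamel:
  assumes sol: "dde_solution_on r (delay_rhs a b F) t0 \<phi> J x"
    and s: "0 \<le> s" "s \<le> t" and J: "{s..t} \<subseteq> J"
  shows "x t = duhamel s x t"
proof -
  have "x t $ i = duhamel s x t $ i" for i
  proof -
    let ?g = "\<lambda>u. exp (A i u) * (b i u * F (segment r x u) $ i)"
    have "((\<lambda>u. exp (A i u) * x u $ i) has_real_derivative ?g u) (at u within {s..t})"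
      if u: "u \<in> {s..t}" for u
    proof -
      have "(A i has_real_derivative a i u) (at u within {s..t})"
        by (rule DERIV_subset[OF A_has_derivative]) (use s u in auto)
      moreover have "(x has_vector_derivative delay_rhs a b F u (segment r x u)) (at u within {s..t})"
        by (rule has_vector_derivative_within_subset[OF _ J]) (use sol J u in \<open>auto simp: dde_solution_on_def\<close>)
      then have "((\<lambda>u. x u $ i) has_real_derivative delay_rhs a b F u (segment r x u) $ i)
          (at u within {s..t})"
        unfolding has_real_derivative_iff_has_vector_derivative has_vector_derivative_def
        by (drule_tac bounded_linear.has_derivative[OF bounded_linear_vec_nth[of i]]) simp
      ultimately show ?thesis
        by (auto intro!: derivative_eq_intros simp: delay_rhs_nth[OF r] algebra_simps)
    qed
    then have "(?g has_integral (exp (A i t) * x t $ i - exp (A i s) * x s $ i)) {s..t}"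
      by (intro fundamental_theorem_of_calculus s)
        (simp add: has_real_derivative_iff_has_vector_derivative)
    then have "integral {s..t} ?g = exp (A i t) * x t $ i - exp (A i s) * x s $ i"
      by (rule integral_unique)
    then show ?thesis
      by (simp add: duhamel_def exp_minus field_simps)
  qed
  then show ?thesis by (simp add: vec_eq_iff)
qed

lemma duhamel_fixed_point_is_solution:
  assumes t0: "0 \<le> t0" and \<phi>: "\<phi> \<in> hist_space r"
    and x: "continuous_on {t0 - r..} x"
    and init: "\<And>\<theta>. \<theta> \<in> {-r..0} \<Longrightarrow> x (t0 + \<theta>) = \<phi> \<theta>"
    and eq: "\<And>t. t0 \<le> t \<Longrightarrow> x t = duhamel t0 x t"
  shows "dde_solution_on r (delay_rhs a b F) t0 \<phi> {t0..} x"
  unfolding dde_solution_on_def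
proof (intro conjI ballI)
  show "continuous_on ({t0 - r..t0} \<union> {t0..}) x"
    by (rule continuous_on_subset[OF x]) (use r in auto)
  show "segment r x t0 = \<phi>"
    using init \<phi> by (auto simp: segment_def hist_space_def extensional_def fun_eq_iff restrict_def)
  fix t assume "t \<in> {t0..}"
  then have t: "t0 \<le> t" by simp
  show "(x has_vector_derivative delay_rhs a b F t (segment r x t)) (at t within {t0..})"
  proof (rule has_vector_derivative_componentwise_cart)
    fix i
    have "((\<lambda>t. duhamel t0 x t $ i) has_real_derivative delay_rhs a b F t (segment r x t) $ i)
        (at t within {t0..})"
      using duhamel_has_derivative[OF t0 t x, of i] eq[OF t] by (simp add: delay_rhs_nth[OF r])
    then show "((\<lambda>t. x t $ i) has_real_derivative delay_rhs a b F t (segment r x t) $ i)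
        (at t within {t0..})"
      by (rule has_field_derivative_transform_within[OF _ zero_less_one]) (use t eq in auto)
  qed
qed

lemma damping_tendsto_0: "((\<lambda>t. exp (A i s - A i t) * C) \<longlongrightarrow> 0) at_top"
proof -
  have "((\<lambda>t. inverse (exp (A i t))) \<longlongrightarrow> 0) at_top"
    by (intro tendsto_inverse_0_at_top filterlim_compose[OF exp_at_top A_at_top])
  from tendsto_mult_right[OF this, of "exp (A i s) * C"] show ?thesis
    by (simp add: exp_diff divide_inverse ac_simps)
qed

text \<open>\<open>A i\<close> is bounded below on \<open>[0, \<infinity>)\<close>, being continuous with limit \<open>\<infinity>\<close>. The damping factor may
  exceed \<open>1\<close> since \<open>a i\<close> can change sign.\<close>

lemma damping_bounded: "\<exists>M>0. \<forall>t\<ge>0. \<forall>i. exp (A i s - A i t) \<le> M"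
proof -
  have "\<exists>m. \<forall>t\<ge>0. m \<le> A i t" for i
  proof -
    obtain T where T: "\<And>t. t \<ge> T \<Longrightarrow> 0 \<le> A i t"
      using A_at_top[of i] unfolding filterlim_at_top eventually_at_top_linorder by blast
    have "continuous_on {0..max 0 T} (A i)"
      by (rule continuous_on_subset[OF continuous_on_A]) auto
    then have "\<exists>p\<in>{0..max 0 T}. \<forall>t\<in>{0..max 0 T}. A i p \<le> A i t"
      by (intro continuous_attains_inf) auto
    then obtain p where p: "\<And>t. t \<in> {0..max 0 T} \<Longrightarrow> A i p \<le> A i t"
      by blast
    have "min 0 (A i p) \<le> A i t" if "0 \<le> t" for t
      using T[of t] p[of t] that by (cases "t \<le> T") auto
    then show ?thesis by blast
  qed
  then obtain m where m: "\<And>i t. 0 \<le> t \<Longrightarrow> m i \<le> A i t"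
    by metis
  let ?M = "\<Sum>i\<in>UNIV. exp (A i s - m i)"
  have "exp (A i s - A i t) \<le> ?M" if "0 \<le> t" for i t
  proof -
    have "exp (A i s - A i t) \<le> exp (A i s - m i)"
      using m[OF that, of i] by simp
    also have "\<dots> \<le> ?M"
      by (rule member_le_sum) auto
    finally show ?thesis .
  qed
  moreover have "0 < ?M"
    by (rule sum_pos) auto
  ultimately show ?thesis by blast
qed

section \<open>Attractivity\<close>

text \<open>The formula is restarted at a time \<open>s\<close> whose whole history already satisfies
  \<open>infnorm (x u) \<le> c\<close>; the initial part then dies out, and the memory part is at most \<open>\<alpha> * c\<close>.\<close>

lemma eventual_bound_improves:
  assumes t0: "0 \<le> t0" and x: "continuous_on {t0 - r..} x"
    and eq: "\<And>s t. t0 \<le> s \<Longrightarrow> s \<le> t \<Longrightarrow> x t = duhamel s x t"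
    and c: "0 < c" "c \<le> L" and ev: "\<forall>\<^sub>F t in at_top. infnorm (x t) \<le> c"
  shows "\<forall>\<^sub>F t in at_top. infnorm (x t) \<le> (1 + \<alpha>) / 2 * c"
proof -
  obtain T where T: "\<And>u. u \<ge> T \<Longrightarrow> infnorm (x u) \<le> c"
    using ev unfolding eventually_at_top_linorder by blast
  define s where "s = max T t0 + r"
  have s: "t0 \<le> s" "0 \<le> s" "s - r \<ge> T" "s - r \<ge> t0 - r"
    using r t0 by (auto simp: s_def)
  have pos: "0 < (1 - \<alpha>) / 2 * c" using c \<alpha> by simp
  have "\<forall>\<^sub>F t in at_top. \<forall>i. exp (A i s - A i t) * \<bar>x s $ i\<bar> < (1 - \<alpha>) / 2 * c"
    by (intro eventually_all_finite order_tendstoD(2)[OF damping_tendsto_0 pos])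
  then show ?thesis
    using eventually_ge_at_top[of s]
  proof eventually_elim
    case (elim t)
    show ?case
    proof (rule infnorm_leI_cart)
      fix i
      have "\<bar>duhamel s x t $ i\<bar> \<le> exp (A i s - A i t) * \<bar>x s $ i\<bar> + \<alpha> * c"
        by (intro duhamel_le s elim c T continuous_on_subset[OF x]) (use s in auto)
      also have "\<dots> \<le> (1 - \<alpha>) / 2 * c + \<alpha> * c"
        using elim(1) by (simp add: less_imp_le)
      also have "\<dots> = (1 + \<alpha>) / 2 * c"
        by (simp add: field_simps)
      finally show "\<bar>x t $ i\<bar> \<le> (1 + \<alpha>) / 2 * c"
        using eq[OF s(1) elim(2)] by simp
    qed
  qed
qed

lemma bounded_solution_tendsto_0:
  assumes t0: "0 \<le> t0" and x: "continuous_on {t0 - r..} x"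
    and eq: "\<And>s t. t0 \<le> s \<Longrightarrow> s \<le> t \<Longrightarrow> x t = duhamel s x t"
    and bound: "\<And>t. t0 \<le> t \<Longrightarrow> infnorm (x t) \<le> L"
  shows "(x \<longlongrightarrow> 0) at_top"
proof -
  define q where "q = (1 + \<alpha>) / 2"
  have q: "0 < q" "q < 1" using \<alpha> by (auto simp: q_def)
  have ev: "\<forall>\<^sub>F t in at_top. infnorm (x t) \<le> q ^ k * L" for k
  proof (induction k)
    case 0
    show ?case using eventually_ge_at_top[of t0] by eventually_elim (simp add: bound)
  next
    case (Suc k)
    have "q ^ k * L \<le> 1 * L"
      using q L by (intro mult_right_mono power_le_one) auto
    then have "\<forall>\<^sub>F t in at_top. infnorm (x t) \<le> (1 + \<alpha>) / 2 * (q ^ k * L)"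
      using q L by (intro eventual_bound_improves[OF t0 x eq _ _ Suc.IH]) auto
    then show ?case by (simp add: q_def mult.assoc)
  qed
  have "((\<lambda>t. infnorm (x t)) \<longlongrightarrow> 0) at_top"
  proof (rule order_tendstoI)
    fix e :: real assume "0 < e"
    then obtain k where "q ^ k < e / L"
      using real_arch_pow_inv[of "e / L" q] q L by auto
    then have k: "q ^ k * L < e"
      using L by (simp add: field_simps)
    show "\<forall>\<^sub>F t in at_top. infnorm (x t) < e"
      using ev[of k] by eventually_elim (use k in linarith)
  next
    fix e :: real assume "e < 0"
    then show "\<forall>\<^sub>F t in at_top. e < infnorm (x t)"
      by (intro always_eventually allI) (use infnorm_pos_le less_le_trans in blast)
  qed
  from tendsto_mult_right_zero[OF this, of "sqrt (real CARD('n))"] show ?thesis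
    by (rule Lim_null_comparison[rotated])
      (intro always_eventually allI norm_le_sqrt_card_infnorm)
qed

section \<open>Uniqueness\<close>

text \<open>At a point where \<open>infnorm (x t - y t)\<close> is maximal, the contraction estimate bounds the
  maximum by \<open>\<alpha>\<close> times itself.\<close>

lemma solutions_in_ball_agree:
  assumes t0: "0 \<le> t0" "t0 \<le> S"
    and x: "dde_solution_on r (delay_rhs a b F) t0 \<phi> I x" "{t0..S} \<subseteq> I"
    and y: "dde_solution_on r (delay_rhs a b F) t0 \<phi> J y" "{t0..S} \<subseteq> J"
    and xL: "\<And>u. u \<in> {t0 - r..S} \<Longrightarrow> infnorm (x u) \<le> L"
    and yL: "\<And>u. u \<in> {t0 - r..S} \<Longrightarrow> infnorm (y u) \<le> L"
    and t: "t \<in> {t0..S}"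
  shows "x t = y t"
proof -
  have init: "x u = y u" if "u \<in> {t0 - r..t0}" for u
  proof -
    have "segment r x t0 (u - t0) = segment r y t0 (u - t0)"
      using x(1) y(1) by (simp add: dde_solution_on_def)
    then show ?thesis using that by (simp add: segment_def)
  qed
  have sub: "{t0 - r..S} \<subseteq> {t0 - r..t0} \<union> {t0..S}" by auto
  have whole: "continuous_on ({t0 - r..t0} \<union> I) x" "continuous_on ({t0 - r..t0} \<union> J) y"
    using x(1) y(1) by (simp_all add: dde_solution_on_def)
  have cont: "continuous_on {t0 - r..S} x" "continuous_on {t0 - r..S} y"
    using sub x(2) y(2)
    by (blast intro: continuous_on_subset[OF whole(1)] continuous_on_subset[OF whole(2)])+
  then have "continuous_on {t0 - r..S} (\<lambda>u. infnorm (x u - y u))"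
    by (intro continuous_intros)
  then have "\<exists>m\<in>{t0 - r..S}. \<forall>u\<in>{t0 - r..S}. infnorm (x u - y u) \<le> infnorm (x m - y m)"
    by (intro continuous_attains_sup) (use t0 r in auto)
  then obtain m where m: "m \<in> {t0 - r..S}"
    and max: "\<And>u. u \<in> {t0 - r..S} \<Longrightarrow> infnorm (x u - y u) \<le> infnorm (x m - y m)"
    by blast
  have "infnorm (x m - y m) \<le> \<alpha> * infnorm (x m - y m)"
  proof (cases "m \<le> t0")
    case True
    then show ?thesis using init[of m] m by (simp add: infnorm_0)
  next
    case False
    show ?thesis
    proof (rule infnorm_leI_cart)
      fix i
      have "\<bar>duhamel t0 x m $ i - duhamel t0 y m $ i\<bar>
          \<le> exp (A i t0 - A i m) * \<bar>x t0 $ i - y t0 $ i\<bar> + \<alpha> * infnorm (x m - y m)"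
        by (intro duhamel_diff_le t0 xL yL max continuous_on_subset[OF cont(1)]
            continuous_on_subset[OF cont(2)]) (use False m in auto)
      moreover have "x m = duhamel t0 x m" "y m = duhamel t0 y m"
        using x y m False t0 by (auto intro!: solution_eq_duhamel)
      ultimately show "\<bar>(x m - y m) $ i\<bar> \<le> \<alpha> * infnorm (x m - y m)"
        using init[of t0] r by simp
    qed
  qed
  then have "(1 - \<alpha>) * infnorm (x m - y m) \<le> 0"
    by (simp add: algebra_simps)
  then have "infnorm (x m - y m) \<le> 0"
    using \<alpha> by (simp add: mult_le_0_iff)
  then have "infnorm (x t - y t) \<le> 0"
    using max[of t] t r by auto
  then show ?thesis
    using infnorm_pos_lt[of "x t - y t"] by auto
qed

text \<open>A solution \<open>y\<close> with the same history cannot leave the ball of radius \<open>L\<close>: up to the first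
  time at which it reaches the sphere it would agree with \<open>x\<close>, which stays strictly inside.\<close>

lemma solution_unique:
  assumes t0: "0 \<le> t0"
    and x: "dde_solution_on r (delay_rhs a b F) t0 \<phi> {t0..} x"
    and c: "c < L" and xc: "\<And>u. t0 - r \<le> u \<Longrightarrow> infnorm (x u) \<le> c"
    and y: "dde_solution_on r (delay_rhs a b F) t0 \<phi> {t0..T} y"
    and t: "t \<in> {t0..T}"
  shows "y t = x t"
proof -
  have init: "y u = x u" if "u \<in> {t0 - r..t0}" for u
  proof -
    have "segment r y t0 (u - t0) = segment r x t0 (u - t0)"
      using x y by (simp add: dde_solution_on_def)
    then show ?thesis using that by (simp add: segment_def)
  qed
  have agree: "y u = x u" if S: "S \<le> T" and yL: "\<And>v. v \<in> {t0..S} \<Longrightarrow> infnorm (y v) \<le> L"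
    and u: "u \<in> {t0..S}" for S u
  proof (rule solutions_in_ball_agree[OF t0 _ y _ x])
    show "t0 \<le> S" "{t0..S} \<subseteq> {t0..T}" "{t0..S} \<subseteq> {t0..}" "u \<in> {t0..S}" using S u by auto
    fix v assume v: "v \<in> {t0 - r..S}"
    then show "infnorm (x v) \<le> L" using xc[of v] c by auto
    then show "infnorm (y v) \<le> L" using init[of v] yL[of v] v by (cases "v \<le> t0") auto
  qed
  define Z where "Z = {v \<in> {t0..T}. L \<le> infnorm (y v)}"
  have ycont: "continuous_on {t0..T} y"
    using y continuous_on_subset[of "{t0 - r..t0} \<union> {t0..T}" y "{t0..T}"]
    by (simp add: dde_solution_on_def)
  have "Z = {}"
  proof (rule ccontr)
    assume "Z \<noteq> {}"
    have "closed Z" unfolding Z_def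
      by (intro continuous_on_closed_Collect_le ycont continuous_on_infnorm) auto
    moreover have "bounded Z"
      by (rule bounded_subset[of "{t0..T}"]) (auto simp: Z_def)
    ultimately have "compact Z" by (simp add: compact_eq_bounded_closed)
    then obtain \<tau> where \<tau>: "\<tau> \<in> Z" and first: "\<And>v. v \<in> Z \<Longrightarrow> \<tau> \<le> v"
      using compact_attains_inf[OF _ \<open>Z \<noteq> {}\<close>] by blast
    have \<tau>T: "t0 \<le> \<tau>" "\<tau> \<le> T" "L \<le> infnorm (y \<tau>)" using \<tau> by (auto simp: Z_def)
    have "infnorm (y t0) \<le> L" using init[of t0] xc[of t0] c r by auto
    moreover have "continuous_on {t0..\<tau>} (\<lambda>v. infnorm (y v))"
      using \<tau>T by (intro continuous_intros continuous_on_subset[OF ycont]) auto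
    ultimately obtain v where v: "t0 \<le> v" "v \<le> \<tau>" "infnorm (y v) = L"
      using IVT'[of "\<lambda>v. infnorm (y v)" t0 L \<tau>] \<tau>T by blast
    then have "v \<in> Z" using \<tau>T by (auto simp: Z_def)
    with v first have y\<tau>: "infnorm (y \<tau>) = L" by (metis order_antisym)
    have "infnorm (y v) \<le> L" if "v \<in> {t0..\<tau>}" for v
    proof (rule ccontr)
      assume *: "\<not> infnorm (y v) \<le> L"
      then have "v \<in> Z" using that \<tau>T by (auto simp: Z_def)
      then have "v = \<tau>" using first that by force
      with * y\<tau> show False by simp
    qed
    then have "y \<tau> = x \<tau>" using \<tau>T by (intro agree[of \<tau>]) auto
    then show False using y\<tau> xc[of \<tau>] \<tau>T c r by auto
  qed
  then have "infnorm (y v) \<le> L" if "v \<in> {t0..T}" for v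
    using that by (auto simp: Z_def)
  then show ?thesis using t by (intro agree[of T]) auto
qed

section \<open>Existence\<close>

lemma continuous_on_duhamel:
  assumes "0 \<le> s" "continuous_on {s - r..} x"
  shows "continuous_on {s..} (duhamel s x)"
proof -
  have "continuous_on {s..} (\<lambda>t. duhamel s x t $ i)" for i
    by (rule DERIV_continuous_on[OF duhamel_has_derivative]) (use assms in auto)
  then have "continuous_on {s..} (\<lambda>t. \<chi> i. duhamel s x t $ i)"
    by (intro continuous_on_vec_lambda)
  then show ?thesis by simp
qed

text \<open>The metric on bounded continuous functions is the supremum of Euclidean distances, which
  is only equivalent to the maximum norm, so the operator itself need not contract there. A high iterate does, since its
  factor \<open>\<alpha> ^ k\<close> absorbs the constant \<open>sqrt n\<close> of that equivalence.\<close>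

lemma duhamel_fixed_point_exists:
  assumes t0: "0 \<le> t0" and \<phi>: "\<phi> \<in> hist_space r"
    and c: "0 < c" "c \<le> L" "hist_norm r \<phi> \<le> c"
    and M: "\<And>t i. t0 \<le> t \<Longrightarrow> exp (A i t0 - A i t) \<le> M"
    and small: "M * hist_norm r \<phi> + \<alpha> * c \<le> c"
  obtains x where "continuous_on UNIV x" "\<And>\<theta>. \<theta> \<in> {-r..0} \<Longrightarrow> x (t0 + \<theta>) = \<phi> \<theta>"
    "\<And>t. t0 \<le> t \<Longrightarrow> x t = duhamel t0 x t" "\<And>t. infnorm (x t) \<le> c"
proof -
  \<comment> \<open>The history is extended by constants to the whole line, because the bounded continuous
    functions form a type with domain \<open>UNIV\<close>.\<close>
  define \<psi> where "\<psi> t = \<phi> (max (-r) (min 0 (t - t0)))" for t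
  define P where "P z t = (if t \<le> t0 then \<psi> t else duhamel t0 z t)" for z t
  define X where "X t = (if t \<le> t0 then {\<psi> t} else {v. infnorm v \<le> c})" for t
  define S where "S = PiC UNIV X"
  define f where "f z = Bcontfun (P (apply_bcontfun z))" for z :: "real \<Rightarrow>\<^sub>C (real ^ 'n)"
  have \<psi>_cont: "continuous_on UNIV \<psi>"
  proof -
    have "continuous_on {-r..0} \<phi>" using \<phi> by (simp add: hist_space_def)
    then show ?thesis unfolding \<psi>_def
      by (rule continuous_on_compose2) (use r in \<open>auto intro!: continuous_intros\<close>)
  qed
  have \<psi>_le: "infnorm (\<psi> t) \<le> hist_norm r \<phi>" for t
    unfolding \<psi>_def by (rule hist_norm_ge[OF \<phi>]) (use r in auto)
  have bcontfunI: "z \<in> bcontfun" if "continuous_on UNIV z" "\<And>t. infnorm (z t) \<le> c"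
    for z :: "real \<Rightarrow> real ^ 'n"
  proof (rule bcontfun_normI[OF that(1)])
    fix t
    have "norm (z t) \<le> sqrt (real CARD('n)) * infnorm (z t)"
      by (rule norm_le_sqrt_card_infnorm)
    also have "\<dots> \<le> sqrt (real CARD('n)) * c"
      by (intro mult_left_mono that) simp
    finally show "norm (z t) \<le> sqrt (real CARD('n)) * c" .
  qed
  have S_iff: "z \<in> S \<longleftrightarrow> (\<forall>t. apply_bcontfun z t \<in> X t)" for z
    by (simp add: S_def mem_PiC_iff Pi_iff)
  have S_init: "apply_bcontfun z t = \<psi> t" if "z \<in> S" "t \<le> t0" for z t
    using that by (simp add: S_iff X_def) (metis singletonD)
  have S_le: "infnorm (apply_bcontfun z t) \<le> c" if "z \<in> S" for z t
    using that \<psi>_le[of t] c(3) S_init[OF that, of t] unfolding S_iff X_def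
    by (cases "t \<le> t0") (auto dest!: spec[of _ t])
  have P_cont: "continuous_on UNIV (P (apply_bcontfun z))" if "z \<in> S" for z
  proof -
    have "duhamel t0 (apply_bcontfun z) t0 = \<psi> t0"
      using S_init[OF that, of t0] by (simp add: duhamel_def vec_eq_iff exp_minus)
    then have "continuous_on ({..t0} \<union> {t0..}) (P (apply_bcontfun z))"
      unfolding P_def
      by (intro continuous_on_cases continuous_on_duhamel t0 continuous_on_subset[OF \<psi>_cont])
        auto
    moreover have "{..t0} \<union> {t0..} = UNIV" by auto
    ultimately show ?thesis by simp
  qed
  have P_le: "infnorm (P (apply_bcontfun z) t) \<le> c" if z: "z \<in> S" for z t
  proof (cases "t \<le> t0")
    case True
    then show ?thesis using \<psi>_le[of t] c(3) by (simp add: P_def)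
  next
    case False
    have "infnorm (duhamel t0 (apply_bcontfun z) t) \<le> c"
    proof (rule infnorm_leI_cart)
      fix i
      have "\<bar>duhamel t0 (apply_bcontfun z) t $ i\<bar>
          \<le> exp (A i t0 - A i t) * \<bar>apply_bcontfun z t0 $ i\<bar> + \<alpha> * c"
        by (intro duhamel_le t0 c S_le z) (use False in auto)
      also have "\<bar>apply_bcontfun z t0 $ i\<bar> \<le> hist_norm r \<phi>"
        using component_le_infnorm_cart[of "\<psi> t0" i] \<psi>_le[of t0] S_init[OF z, of t0] by simp
      also have "exp (A i t0 - A i t) * hist_norm r \<phi> \<le> M * hist_norm r \<phi>"
        using M[of t i] False order_trans[OF infnorm_pos_le \<psi>_le] by (intro mult_right_mono) auto
      finally show "\<bar>duhamel t0 (apply_bcontfun z) t $ i\<bar> \<le> c"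
        using small by simp
    qed
    then show ?thesis using False by (simp add: P_def)
  qed
  have f_apply: "apply_bcontfun (f z) = P (apply_bcontfun z)" if "z \<in> S" for z
    unfolding f_def by (intro Bcontfun_inverse bcontfunI P_cont P_le that)
  have f_S: "f z \<in> S" if "z \<in> S" for z
    unfolding S_iff f_apply[OF that]
  proof
    fix t
    show "P (apply_bcontfun z) t \<in> X t"
      using P_le[OF that, of t] by (cases "t \<le> t0") (auto simp: X_def P_def)
  qed
  have f_contract: "infnorm (apply_bcontfun (f z) t - apply_bcontfun (f w) t) \<le> \<alpha> * d"
    if z: "z \<in> S" and w: "w \<in> S"
      and d: "\<And>t. infnorm (apply_bcontfun z t - apply_bcontfun w t) \<le> d" for z w t d
  proof (cases "t \<le> t0")
    case True
    have "0 \<le> d" using d[of 0] infnorm_pos_le order_trans by blast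
    then show ?thesis using True \<alpha> by (simp add: f_apply z w P_def infnorm_0)
  next
    case False
    have "infnorm (duhamel t0 (apply_bcontfun z) t - duhamel t0 (apply_bcontfun w) t) \<le> \<alpha> * d"
    proof (rule infnorm_leI_cart)
      fix i
      have "\<bar>duhamel t0 (apply_bcontfun z) t $ i - duhamel t0 (apply_bcontfun w) t $ i\<bar>
          \<le> exp (A i t0 - A i t) * \<bar>apply_bcontfun z t0 $ i - apply_bcontfun w t0 $ i\<bar> + \<alpha> * d"
        by (intro duhamel_diff_le t0 d order_trans[OF S_le c(2)] z w) (use False in auto)
      then show "\<bar>(duhamel t0 (apply_bcontfun z) t - duhamel t0 (apply_bcontfun w) t) $ i\<bar> \<le> \<alpha> * d"
        by (simp add: S_init z w)
    qed
    then show ?thesis using False by (simp add: f_apply z w P_def)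
  qed
  have iterate_S: "(f ^^ k) z \<in> S" if "z \<in> S" for k z
    using that f_S by (induction k) auto
  have iterate: "infnorm (apply_bcontfun ((f ^^ k) z) t - apply_bcontfun ((f ^^ k) w) t)
      \<le> \<alpha> ^ k * dist z w" if z: "z \<in> S" and w: "w \<in> S" for k z w t
  proof (induction k arbitrary: t)
    case 0
    show ?case
      using infnorm_le_norm[of "apply_bcontfun z t - apply_bcontfun w t"] dist_bounded[of z t w]
      by (simp add: dist_norm)
  next
    case (Suc k)
    show ?case
      using f_contract[OF iterate_S[OF z] iterate_S[OF w] Suc.IH, of t] by (simp add: mult.assoc)
  qed
  let ?q = "sqrt (real CARD('n))"
  have q: "0 < ?q" by simp
  obtain k where "\<alpha> ^ k < 1 / ?q"
    using real_arch_pow_inv[of "1 / ?q" \<alpha>] \<alpha> q by auto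
  then have k: "?q * \<alpha> ^ k < 1"
    using q by (simp add: field_simps)
  have "\<exists>z\<in>S. f z = z"
  proof (rule Banach_fix_iterate[where k = k and c = "?q * \<alpha> ^ k"])
    have "closed (X t)" for t
    proof -
      have "closed {v :: real ^ 'n. infnorm v \<le> c}"
        by (intro closed_Collect_le continuous_intros)
      then show ?thesis by (simp add: X_def)
    qed
    then show "complete S"
      unfolding S_def complete_eq_closed by (intro closed_PiC)
    have "\<psi> \<in> bcontfun"
      using \<psi>_le c(3) by (intro bcontfunI \<psi>_cont) (rule order_trans)
    then have "Bcontfun \<psi> \<in> S"
      using order_trans[OF \<psi>_le c(3)] by (simp add: S_iff Bcontfun_inverse X_def)
    then show "S \<noteq> {}" by blast
    show "0 \<le> ?q * \<alpha> ^ k" "?q * \<alpha> ^ k < 1" using k \<alpha> by auto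
    show "f ` S \<subseteq> S" using f_S by blast
    fix z w assume zw: "z \<in> S" "w \<in> S"
    show "dist ((f ^^ k) z) ((f ^^ k) w) \<le> ?q * \<alpha> ^ k * dist z w"
    proof (rule dist_bound)
      fix t
      let ?v = "apply_bcontfun ((f ^^ k) z) t - apply_bcontfun ((f ^^ k) w) t"
      have "norm ?v \<le> ?q * infnorm ?v" by (rule norm_le_sqrt_card_infnorm)
      also have "\<dots> \<le> ?q * (\<alpha> ^ k * dist z w)" by (intro mult_left_mono iterate zw) simp
      finally show "dist (apply_bcontfun ((f ^^ k) z) t) (apply_bcontfun ((f ^^ k) w) t)
          \<le> ?q * \<alpha> ^ k * dist z w" by (simp add: dist_norm mult.assoc)
    qed
  qed
  then obtain z where z: "z \<in> S" "f z = z" by blast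
  let ?x = "apply_bcontfun z"
  have fixed: "P ?x = ?x" using f_apply[OF z(1)] z(2) by simp
  show thesis
  proof
    show "continuous_on UNIV ?x" by simp
    show "infnorm (?x t) \<le> c" for t by (rule S_le[OF z(1)])
    show "?x (t0 + \<theta>) = \<phi> \<theta>" if "\<theta> \<in> {-r..0}" for \<theta>
      using S_init[OF z(1), of "t0 + \<theta>"] that by (simp add: \<psi>_def)
    show "?x t = duhamel t0 ?x t" if "t0 \<le> t" for t
    proof (cases "t = t0")
      case True
      then show ?thesis by (simp add: duhamel_def vec_eq_iff exp_minus)
    next
      case False
      then show ?thesis using fun_cong[OF fixed, of t] that by (simp add: P_def)
    qed
  qed
qed

section \<open>Asymptotic stability\<close>

lemma small_histories_have_small_decaying_solutions:
  assumes t0: "0 \<le> t0" and \<epsilon>: "0 < \<epsilon>"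
  shows "\<exists>\<delta>>0. \<forall>\<phi>\<in>hist_space r. hist_norm r \<phi> \<le> \<delta> \<longrightarrow>
    (\<exists>x. is_global_dde_solution r (delay_rhs a b F) t0 \<phi> x \<and>
      (\<forall>t\<ge>t0. infnorm (x t) < \<epsilon>) \<and> (x \<longlongrightarrow> 0) at_top)"
proof -
  \<comment> \<open>Strictly below \<open>L\<close>, as uniqueness requires, and strictly below \<open>\<epsilon>\<close>.\<close>
  define c where "c = min \<epsilon> L / 2"
  have c: "0 < c" "c < \<epsilon>" "c < L" using \<epsilon> L by (auto simp: c_def)
  obtain M where M: "0 < M" "\<And>t i. 0 \<le> t \<Longrightarrow> exp (A i t0 - A i t) \<le> M"
    using damping_bounded by blast
  \<comment> \<open>The second bound makes \<open>M * \<delta> + \<alpha> * c \<le> c\<close>, so that the operator preserves the bound \<open>c\<close>.\<close>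
  define \<delta> where "\<delta> = min c ((1 - \<alpha>) * c / M)"
  have \<delta>: "0 < \<delta>" "\<delta> \<le> c" "M * \<delta> \<le> (1 - \<alpha>) * c"
    using c M(1) \<alpha> by (auto simp: \<delta>_def min_def field_simps)
  show ?thesis
  proof (intro exI[of _ \<delta>] conjI ballI impI \<delta>)
    fix \<phi> :: "real \<Rightarrow> real ^ 'n" assume \<phi>: "\<phi> \<in> hist_space r" and small: "hist_norm r \<phi> \<le> \<delta>"
    have "M * hist_norm r \<phi> \<le> M * \<delta>" using M(1) small by simp
    then have "M * hist_norm r \<phi> + \<alpha> * c \<le> c" using \<delta>(3) by (simp add: algebra_simps)
    moreover have "exp (A i t0 - A i t) \<le> M" if "t0 \<le> t" for t i
      using M(2) t0 that by simp
    ultimately obtain x where x: "continuous_on UNIV x"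
      and init: "\<And>\<theta>. \<theta> \<in> {-r..0} \<Longrightarrow> x (t0 + \<theta>) = \<phi> \<theta>"
      and eq: "\<And>t. t0 \<le> t \<Longrightarrow> x t = duhamel t0 x t" and xc: "\<And>t. infnorm (x t) \<le> c"
      using duhamel_fixed_point_exists[OF t0 \<phi> c(1) less_imp_le[OF c(3)] order_trans[OF small \<delta>(2)]]
      by blast
    have cont: "continuous_on {t0 - r..} x" using x continuous_on_subset by blast
    have sol: "dde_solution_on r (delay_rhs a b F) t0 \<phi> {t0..} x"
      by (rule duhamel_fixed_point_is_solution[OF t0 \<phi> cont init eq])
    have "is_global_dde_solution r (delay_rhs a b F) t0 \<phi> x"
      unfolding is_global_dde_solution_def
      using sol solution_unique[OF t0 sol c(3) xc] by blast
    moreover have "\<forall>t\<ge>t0. infnorm (x t) < \<epsilon>"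
      using xc c(2) by (meson le_less_trans)
    moreover have "(x \<longlongrightarrow> 0) at_top"
    proof (rule bounded_solution_tendsto_0[OF t0 cont])
      show "x t = duhamel s x t" if "t0 \<le> s" "s \<le> t" for s t
        by (rule solution_eq_duhamel[OF sol]) (use that t0 in auto)
      show "infnorm (x t) \<le> L" for t using xc[of t] c(3) by simp
    qed
    ultimately show "\<exists>x. is_global_dde_solution r (delay_rhs a b F) t0 \<phi> x \<and>
      (\<forall>t\<ge>t0. infnorm (x t) < \<epsilon>) \<and> (x \<longlongrightarrow> 0) at_top" by blast
  qed
qed

lemma asymptotically_stable: "zero_asymptotically_stable r (delay_rhs a b F)"
proof -
  have "zero_stable r (delay_rhs a b F)"
    unfolding zero_stable_def using small_histories_have_small_decaying_solutions by meson
  moreover have "zero_attractive r (delay_rhs a b F)"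
    unfolding zero_attractive_def
    using small_histories_have_small_decaying_solutions[OF _ zero_less_one] by meson
  ultimately show ?thesis by (simp add: zero_asymptotically_stable_def)
qed

end

theorem theorem3p1:
  fixes r L K :: real
    and a b :: "'n::finite \<Rightarrow> real \<Rightarrow> real"
    and F :: "(real \<Rightarrow> real ^ 'n) \<Rightarrow> real ^ 'n"
  assumes "r > 0"
    and "\<And>i. continuous_on UNIV (a i)"
    and "\<And>i. continuous_on UNIV (b i)"
    and "hist_continuous r F"
    and "F (hist_zero r) = 0"
    and "\<And>i. filterlim (\<lambda>t. integral {0..t} (a i)) at_top at_top"
    and "L > 0" and "K > 0"
    and "\<And>\<phi> \<psi>. \<phi> \<in> hist_space r \<Longrightarrow> \<psi> \<in> hist_space r \<Longrightarrow>
           hist_norm r \<phi> \<le> L \<Longrightarrow> hist_norm r \<psi> \<le> L \<Longrightarrow>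
           infnorm (F \<phi> - F \<psi>) \<le> K * hist_dist r \<phi> \<psi>"
    and "\<exists>\<alpha>. 0 < \<alpha> \<and> \<alpha> < 1 \<and>
           (\<forall>t\<ge>0. \<forall>i. K * integral {0..t}
              (\<lambda>s. exp (- integral {s..t} (a i)) * \<bar>b i s\<bar>) \<le> \<alpha>)"
  shows "zero_asymptotically_stable r (delay_rhs a b F)"
proof -
  from assms(10) obtain \<alpha> where \<alpha>: "0 < \<alpha>" "\<alpha> < 1"
    "\<And>t i. t \<ge> 0 \<Longrightarrow>
      K * integral {0..t} (\<lambda>s. exp (- integral {s..t} (a i)) * \<bar>b i s\<bar>) \<le> \<alpha>"
    by blast
  interpret diagonal_delay_equation r L K \<alpha> a b F
    by unfold_locales (fact assms(1-9) \<alpha>)+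
  show ?thesis by (rule asymptotically_stable)
qed

end
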